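(* Let $n$ be a positive integer. The following are equivalent: (a) there exists an $n\times n$ matrix with entries from $\{-1,0,1\}$, with mutually orthogonal columns, one of which is the all-ones vector $\mathbf{1}$; (b) there is a connected simple graph on $n$ vertices with $\{-1,0,1\}$-bandwidth $1$; (c) the complete graph $K_n$ has $\{-1,0,1\}$-bandwidth $1$.
   Context: For a simple graph with adjacency matrix $A$ and degree matrix $D$, the Laplacian is $L=D-A$. The bandwidth of a square matrix $M$ is the smallest positive integer $k$ with $m_{i,j}=0$ whenever $|i-j|\ge k$. The $\{-1,0,1\}$-bandwidth of a graph is $\infty$ if there is no invertible matrix with entries in $\{-1,0,1\}$ diagonalizing $L$, and otherwise the smallest positive integer $k$ for which there is a matrix $P$ with entries in $\{-1,0,1\}$, $P^{-1}LP$ diagonal, and $P^TP$ of bandwidth $k$.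
   Formalization: In (a) the mutually orthogonal columns are required to be nonzero; if zero columns were allowed, the all-ones column together with zero columns would satisfy (a) for every n, and the equivalence would fail, for example at n = 3. *)

theory Defs
  imports
    Complex_Main
    "HOL-Library.Extended_Nat"
    "Jordan_Normal_Form.Matrix"
    "Graph_Theory.Kuratowski"
begin

text \<open>
  Simple graphs are \<^locale>\<open>pair_graph\<close>s (finite, loopless, symmetric arc relation). A graph on
  $n$ vertices is taken with vertex set $\{0,\dots,n-1\}$, so that vertex $i$ indexes row and
  column $i$ of its matrices; the matrices below are only meaningful for such vertex sets.
\<close>

definition adjacency_mat :: "nat pair_pre_digraph \<Rightarrow> real mat" where
  "adjacency_mat G =
     mat (card (pverts G)) (card (pverts G)) (\<lambda>(i, j). if (i, j) \<in> parcs G then 1 else 0)"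

text \<open>The arc relation is symmetric, so the out-degree is the degree of the simple graph.\<close>

definition degree_mat :: "nat pair_pre_digraph \<Rightarrow> real mat" where
  "degree_mat G = mat_diag (card (pverts G)) (\<lambda>i. real (out_degree (with_proj G) i))"

definition laplacian :: "nat pair_pre_digraph \<Rightarrow> real mat" where
  "laplacian G = degree_mat G - adjacency_mat G"

definition mat_bandwidth :: "'a :: zero mat \<Rightarrow> nat" where
  "mat_bandwidth M = (LEAST k. 0 < k \<and>
     (\<forall>i < dim_row M. \<forall>j < dim_col M. \<bar>int i - int j\<bar> \<ge> int k \<longrightarrow> M $$ (i, j) = 0))"

definition diagonalizes :: "'a :: semiring_1 mat \<Rightarrow> 'a mat \<Rightarrow> bool" where
  "diagonalizes P A \<longleftrightarrow> P \<in> carrier_mat (dim_row A) (dim_row A) \<and>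
     (\<exists>Q. inverts_mat P Q \<and> inverts_mat Q P \<and> diagonal_mat (Q * A * P))"

definition S_bandwidth :: "real set \<Rightarrow> nat pair_pre_digraph \<Rightarrow> enat" where
  "S_bandwidth S G =
     (if \<exists>P. elements_mat P \<subseteq> S \<and> diagonalizes P (laplacian G)
      then enat (LEAST k. 0 < k \<and>
             (\<exists>P. elements_mat P \<subseteq> S \<and> diagonalizes P (laplacian G) \<and>
                  mat_bandwidth (P\<^sup>T * P) = k))
      else \<infinity>)"

definition complete_graph :: "nat \<Rightarrow> nat pair_pre_digraph" where
  "complete_graph n = \<lparr> pverts = {..<n}, parcs = {(u, v). u < n \<and> v < n \<and> u \<noteq> v} \<rparr>"

lemma complete_digraph_complete_graph: "K\<^bsub>n\<^esub> (with_proj (complete_graph n))"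
  by (auto simp: complete_digraph_pair_def complete_graph_def)

text \<open>
  Pitfall: \<^const>\<open>Matrix.orthogonal\<close> demands \<open>(vs ! i \<bullet> vs ! j = 0) = (i \<noteq> j)\<close>, so it also
  excludes (over the reals) zero vectors. For the columns of a square matrix this is intended: if
  zero columns were allowed, the matrix with one all-ones column and zeros elsewhere would make
  the existence of a $\{-1,0,1\}$-matrix with mutually orthogonal columns, one of them all-ones,
  hold trivially for every size.
\<close>

end

theory Submission
  imports Defs "Jordan_Normal_Form.Determinant"
begin

text \<open>
  Bandwidth $1$ means that $P^TP$ is diagonal, i.e. that the columns of $P$ are orthogonal.
  If these columns are eigenvectors of the Laplacian of a connected graph, then one of them spans
  its kernel, which consists of the constant vectors; having entries in $\{-1,0,1\}$, that column
  is $\pm\mathbf{1}$, and the sign can be absorbed into the matrix. Conversely, the Laplacian of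
  $K_n$ is $nI-J$, so $\mathbf{1}$ and every vector orthogonal to it are eigenvectors.
\<close>

section \<open>Bandwidth one as diagonality\<close>

lemma mat_bandwidth_works:
  "0 < mat_bandwidth M \<and> (\<forall>i < dim_row M. \<forall>j < dim_col M.
     \<bar>int i - int j\<bar> \<ge> int (mat_bandwidth M) \<longrightarrow> M $$ (i, j) = 0)"
  \<comment> \<open>This witness exceeds every difference of indices, so its condition holds
    vacuously and the least value is attained.\<close>
  unfolding mat_bandwidth_def by (rule LeastI[of _ "dim_row M + dim_col M + 1"]) auto

lemma mat_bandwidth_eq_1_iff: "mat_bandwidth M = 1 \<longleftrightarrow> diagonal_mat M"
proof
  assume "mat_bandwidth M = 1"
  then show "diagonal_mat M"
    using mat_bandwidth_works[of M] by (auto simp: diagonal_mat_def)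
next
  assume "diagonal_mat M"
  then show "mat_bandwidth M = 1"
    unfolding mat_bandwidth_def by (intro Least_equality) (auto simp: diagonal_mat_def)
qed

text \<open>No admissible value is below 1, so the minimum is 1 exactly when 1 is attained; a Gram
  matrix of bandwidth 1 is a diagonal one.\<close>

lemma S_bandwidth_eq_1_iff:
  "S_bandwidth S G = 1 \<longleftrightarrow>
     (\<exists>P. elements_mat P \<subseteq> S \<and> diagonalizes P (laplacian G) \<and> diagonal_mat (P\<^sup>T * P))"
proof -
  define q where "q = (\<lambda>P. elements_mat P \<subseteq> S \<and> diagonalizes P (laplacian G))"
  define p where "p = (\<lambda>k::nat. 0 < k \<and> (\<exists>P. q P \<and> mat_bandwidth (P\<^sup>T * P) = k))"
  have bw: "S_bandwidth S G = (if \<exists>P. q P then enat (LEAST k. p k) else \<infinity>)"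
    unfolding S_bandwidth_def p_def q_def by simp
  have p1: "p 1 \<longleftrightarrow> (\<exists>P. q P \<and> diagonal_mat (P\<^sup>T * P))"
    by (simp add: p_def mat_bandwidth_eq_1_iff[unfolded One_nat_def])
  \<comment> \<open>Any diagonalizing \<open>P\<close> makes the bandwidth of its own Gram matrix an
    admissible value, so the \<open>LEAST\<close> is genuine.\<close>
  have "p (LEAST k. p k)" if "\<exists>P. q P"
  proof -
    from that obtain P where "q P" by blast
    then have "p (mat_bandwidth (P\<^sup>T * P))" using mat_bandwidth_works by (auto simp: p_def)
    then show ?thesis by (rule LeastI)
  qed
  moreover have "(LEAST k. p k) = 1" if "p 1"
    using that by (rule Least_equality) (simp add: p_def)
  moreover have "\<exists>P. q P" if "p 1"
    using that by (auto simp: p_def)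
  ultimately have "S_bandwidth S G = 1 \<longleftrightarrow> p 1"
    unfolding bw one_enat_def by (metis enat.distinct(1) enat.inject)
  then show ?thesis unfolding p1 by (simp add: q_def conj_assoc)
qed

section \<open>Orthogonal columns, inverses and diagonalization\<close>

lemma orthogonal_cols_iff: "Matrix.orthogonal (cols A) \<longleftrightarrow> orthogonal_mat A"
proof
  assume "Matrix.orthogonal (cols A)"
  from orthogonalD[OF this] show "orthogonal_mat A" by (intro orthogonal_matI) auto
qed (auto intro!: orthogonalI dest: orthogonal_matD)

text \<open>Dividing row \<open>i\<close> of the transpose by
  \<open>col A i \<bullet> col A i\<close>, which \<open>orthogonal_mat\<close> makes nonzero, gives
  a left inverse; for square matrices it is two-sided.\<close>

lemma orthogonal_mat_inverse:
  fixes A :: "'a :: field mat"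
  assumes A: "A \<in> carrier_mat n n" and "orthogonal_mat A"
  obtains B where "B \<in> carrier_mat n n" "A * B = 1\<^sub>m n" "B * A = 1\<^sub>m n"
proof -
  define B where "B = mat n n (\<lambda>(i, j). A $$ (j, i) / (col A i \<bullet> col A i))"
  have B: "B \<in> carrier_mat n n" by (simp add: B_def)
  have "B * A = 1\<^sub>m n"
  proof (rule eq_matI)
    fix i j assume "i < dim_row (1\<^sub>m n :: 'a mat)" "j < dim_col (1\<^sub>m n :: 'a mat)"
    then have ij: "i < n" "j < n" by auto
    have "row B i = (1 / (col A i \<bullet> col A i)) \<cdot>\<^sub>v col A i"
      using ij A by (intro eq_vecI) (auto simp: B_def)
    then have "(B * A) $$ (i, j) = (col A i \<bullet> col A j) / (col A i \<bullet> col A i)"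
      using ij A B by simp
    then show "(B * A) $$ (i, j) = 1\<^sub>m n $$ (i, j)"
      using orthogonal_matD[OF assms(2), of i j] orthogonal_matD[OF assms(2), of i i] ij A by auto
  qed (use A B in auto)
  with mat_mult_left_right_inverse[OF B A] B show thesis by (intro that)
qed

text \<open>The definition leaves the size of \<open>Q\<close> open; comparing the column counts in
  the two inverse equations fixes it.\<close>

lemma diagonalizesE:
  assumes "A \<in> carrier_mat n n" and "diagonalizes P A"
  obtains Q where "P \<in> carrier_mat n n" "Q \<in> carrier_mat n n"
    "P * Q = 1\<^sub>m n" "Q * P = 1\<^sub>m n" "diagonal_mat (Q * A * P)"
proof -
  from assms obtain Q where P: "P \<in> carrier_mat n n" and PQ: "P * Q = 1\<^sub>m n"
    and QP: "Q * P = 1\<^sub>m (dim_row Q)" and E: "diagonal_mat (Q * A * P)"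
    by (auto simp: diagonalizes_def inverts_mat_def)
  have "dim_col Q = n" using arg_cong[OF PQ, of dim_col] by simp
  moreover have "dim_row Q = n" using arg_cong[OF QP, of dim_col] P by simp
  ultimately show thesis using that[OF P _ PQ _ E] QP by auto
qed

text \<open>Column \<open>j\<close> of \<open>A * P\<close> is \<open>e j\<close> times column
  \<open>j\<close> of \<open>P\<close>, so entry \<open>(i, j)\<close> of \<open>Q * A * P\<close>
  is \<open>e j\<close> times that of \<open>Q * P\<close>, the identity.\<close>

lemma diagonalizes_if_eigenvectors:
  fixes A :: "'a :: comm_ring_1 mat"
  assumes A: "A \<in> carrier_mat n n" and P: "P \<in> carrier_mat n n" and Q: "Q \<in> carrier_mat n n"
    and PQ: "P * Q = 1\<^sub>m n" and QP: "Q * P = 1\<^sub>m n"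
    and eig: "\<And>j. j < n \<Longrightarrow> A *\<^sub>v col P j = e j \<cdot>\<^sub>v col P j"
  shows "diagonalizes P A"
proof -
  have "(Q * A * P) $$ (i, j) = 0" if "i < n" "j < n" "i \<noteq> j" for i j
  proof -
    have "(Q * A * P) $$ (i, j) = (Q * (A * P)) $$ (i, j)"
      by (simp add: assoc_mult_mat[OF Q A P])
    also have "\<dots> = row Q i \<bullet> col (A * P) j"
      using that A P Q by (intro index_mult_mat(1)) auto
    also have "\<dots> = row Q i \<bullet> (A *\<^sub>v col P j)"
      using that by (simp only: col_mult2[OF A P])
    also have "\<dots> = e j * (Q * P) $$ (i, j)"
      using that P Q by (simp add: eig)
    finally show ?thesis using that by (simp add: QP)
  qed
  then have "diagonal_mat (Q * A * P)"
    using P Q by (simp add: diagonal_mat_def del: index_mult_mat(1))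
  then show ?thesis
    using A P Q PQ QP by (auto simp: diagonalizes_def inverts_mat_def)
qed

section \<open>The Laplacian and its kernel\<close>

lemma laplacian_carrier: "laplacian G \<in> carrier_mat (card (pverts G)) (card (pverts G))"
  by (auto simp: laplacian_def degree_mat_def adjacency_mat_def mat_diag_def)

text \<open>The degree counts the neighbours, so the diagonal term distributes over them as one copy
  of \<open>v $ i\<close> each. In this form constant vectors visibly lie in the kernel, and the
  signs at a maximum can be read off.\<close>

lemma laplacian_mult_vec:
  assumes G: "pair_graph G" "pverts G = {..<n}" and v: "v \<in> carrier_vec n" and i: "i < n"
  shows "(laplacian G *\<^sub>v v) $ i = (\<Sum>j | (i, j) \<in> parcs G. v $ i - v $ j)"
proof -
  interpret pair_graph G by fact
  let ?N = "{j. (i, j) \<in> parcs G}"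
  have sub: "?N \<subseteq> {0..<n}" using G(2) in_arcsD2 by fastforce
  have "out_arcs (with_proj G) i = Pair i ` ?N" by (auto simp: out_arcs_def)
  then have deg: "out_degree (with_proj G) i = card ?N"
    by (simp add: out_degree_def card_image inj_on_def)
  have entry: "laplacian G $$ (i, j) =
      (if i = j then real (card ?N) else 0) - (if j \<in> ?N then 1 else 0)"
    if "j < n" for j
    using G(2) i that deg
    by (auto simp: laplacian_def degree_mat_def adjacency_mat_def mat_diag_def)
  have "(laplacian G *\<^sub>v v) $ i = (\<Sum>j = 0..<n. laplacian G $$ (i, j) * v $ j)"
    using G(2) v i laplacian_carrier[of G] by (simp add: scalar_prod_def)
  also have "\<dots> = (\<Sum>j = 0..<n.
      (if i = j then real (card ?N) * v $ j else 0) - (if j \<in> ?N then v $ j else 0))"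
    by (rule sum.cong) (auto simp: entry left_diff_distrib)
  also have "\<dots> = real (card ?N) * v $ i - (\<Sum>j\<in>{0..<n} \<inter> ?N. v $ j)"
    using i by (subst sum.inter_restrict) (simp_all add: sum_subtractf)
  also have "{0..<n} \<inter> ?N = ?N" using sub by blast
  finally show ?thesis by (simp add: sum_subtractf)
qed

text \<open>Maximum principle: at a vertex where \<open>v\<close> is maximal, all neighbours have the same value.\<close>

lemma laplacian_kernel_constant:
  assumes G: "pair_graph G" "pverts G = {..<n}" "Digraph_Component.connected (with_proj G)"
    and v: "v \<in> carrier_vec n" and ker: "laplacian G *\<^sub>v v = 0\<^sub>v n"
  obtains c where "v = c \<cdot>\<^sub>v Matrix.vec n (\<lambda>_. 1)"
proof -
  interpret pair_graph G by fact
  have "pverts G \<noteq> {}"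
    using G(3) by (auto simp: Digraph_Component.connected_def strongly_connected_def)
  then have "n > 0" using G(2) by auto
  define m where "m = Max ((\<lambda>i. v $ i) ` {..<n})"
  have "m \<in> (\<lambda>i. v $ i) ` {..<n}" unfolding m_def using \<open>n > 0\<close> by (intro Max_in) auto
  then obtain k where k: "k < n" "v $ k = m" by auto
  have le: "v $ i \<le> m" if "i < n" for i unfolding m_def using that by (intro Max_ge) auto
  have step: "v $ j = m" if arc: "(i, j) \<in> parcs G" and max: "v $ i = m" for i j
  proof -
    have N: "l < n" if "(i, l) \<in> parcs G" for l using that G(2) in_arcsD2 by fastforce
    have i: "i < n" using arc G(2) in_arcsD1 by fastforce
    have fin: "finite {j. (i, j) \<in> parcs G}" by (rule finite_subset[of _ "{..<n}"]) (auto dest: N)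
    have "(\<Sum>j | (i, j) \<in> parcs G. v $ i - v $ j) = 0"
      using laplacian_mult_vec[OF G(1,2) v i] ker i by simp
    \<comment> \<open>At a maximal vertex no summand is negative, so a zero sum forces each of them
      to vanish.\<close>
    then have "\<forall>j\<in>{j. (i, j) \<in> parcs G}. v $ i - v $ j = 0"
      using fin max le N by (subst (asm) sum_nonneg_eq_0_iff) auto
    then show ?thesis using arc max by auto
  qed
  have "v $ i = m" if "i < n" for i
  proof -
    \<comment> \<open>Connectedness is stated for the symmetric closure; the arcs being symmetric,
      it yields a directed path from \<open>k\<close>, along which the value \<open>m\<close>
      propagates.\<close>
    have "k \<rightarrow>\<^sup>*\<^bsub>mk_symmetric (with_proj G)\<^esub> i"
      using G(2,3) k that by (auto simp: Digraph_Component.connected_def strongly_connected_def)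
    then have "k \<rightarrow>\<^sup>*\<^bsub>with_proj G\<^esub> i"
      using reachable_mk_symmetric_eq sym_arcs by simp
    then show ?thesis
      by (induction rule: reachable_induct) (use k step in auto)
  qed
  then have "v = m \<cdot>\<^sub>v Matrix.vec n (\<lambda>_. 1)" using v by (intro eq_vecI) auto
  then show thesis by (rule that)
qed

section \<open>The complete graph\<close>

lemma pair_graph_complete_graph: "pair_graph (complete_graph n)"
  using complete_digraph_complete_graph[of n]
  by (auto simp: complete_digraph_def intro: pair_graphI_graph)

lemma connected_complete_graph:
  assumes "n > 0"
  shows "Digraph_Component.connected (with_proj (complete_graph n))"
proof -
  interpret pair_graph "complete_graph n" by (rule pair_graph_complete_graph)
  have "u \<rightarrow>\<^sup>*\<^bsub>with_proj (complete_graph n)\<^esub> v" if "u < n" "v < n" for u v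
  proof (cases "u = v")
    case True
    show ?thesis unfolding True using that by (intro reachable_refl) (simp add: complete_graph_def)
  next
    case False
    with that have "u \<rightarrow>\<^bsub>with_proj (complete_graph n)\<^esub> v" by (simp add: complete_graph_def)
    then show ?thesis by simp
  qed
  then show ?thesis
    using assms reachable_mk_symmetricI
    by (auto simp: Digraph_Component.connected_def strongly_connected_def complete_graph_def)
qed

lemma laplacian_complete_graph_mult_vec:
  assumes v: "v \<in> carrier_vec n"
  shows "laplacian (complete_graph n) *\<^sub>v v =
    real n \<cdot>\<^sub>v v - (Matrix.vec n (\<lambda>_. 1) \<bullet> v) \<cdot>\<^sub>v Matrix.vec n (\<lambda>_. 1)"
proof (rule eq_vecI)
  have V: "pverts (complete_graph n) = {..<n}" by (simp add: complete_graph_def)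
  fix i assume "i < dim_vec (real n \<cdot>\<^sub>v v - (Matrix.vec n (\<lambda>_. 1) \<bullet> v) \<cdot>\<^sub>v Matrix.vec n (\<lambda>_. 1))"
  then have i: "i < n" by simp
  have "(laplacian (complete_graph n) *\<^sub>v v) $ i = (\<Sum>j\<in>{..<n} - {i}. v $ i - v $ j)"
    unfolding laplacian_mult_vec[OF pair_graph_complete_graph V v i]
    using i by (intro sum.cong) (auto simp: complete_graph_def)
  \<comment> \<open>The added summand for \<open>j = i\<close> is zero.\<close>
  also have "\<dots> = (\<Sum>j<n. v $ i - v $ j)"
    using i by (subst sum.remove[of _ i]) auto
  also have "\<dots> = real n * v $ i - (\<Sum>j<n. v $ j)"
    by (simp add: sum_subtractf)
  finally show "(laplacian (complete_graph n) *\<^sub>v v) $ i =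
      (real n \<cdot>\<^sub>v v - (Matrix.vec n (\<lambda>_. 1) \<bullet> v) \<cdot>\<^sub>v Matrix.vec n (\<lambda>_. 1)) $ i"
    using i v by (simp add: scalar_prod_def atLeast0LessThan)
qed (use v laplacian_carrier[of "complete_graph n"] in \<open>auto simp: complete_graph_def\<close>)

text \<open>The columns of \<open>H\<close> are eigenvectors: eigenvalue 0 for the all-ones column,
  and \<open>n\<close> for the others, on which the all-ones part of the Laplacian vanishes by
  orthogonality.\<close>

lemma diagonalizes_laplacian_complete_graph:
  assumes H: "H \<in> carrier_mat n n" and orth: "orthogonal_mat H"
    and one: "Matrix.vec n (\<lambda>_. 1) \<in> set (cols H)"
  shows "diagonalizes H (laplacian (complete_graph n))"
proof -
  obtain Q where Q: "Q \<in> carrier_mat n n" "H * Q = 1\<^sub>m n" "Q * H = 1\<^sub>m n"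
    using orthogonal_mat_inverse[OF H orth] .
  from one obtain k where k: "k < n" "col H k = Matrix.vec n (\<lambda>_. 1)"
    using H by (auto simp: in_set_conv_nth)
  have "laplacian (complete_graph n) *\<^sub>v col H j = (if j = k then 0 else real n) \<cdot>\<^sub>v col H j"
    if j: "j < n" for j
  proof -
    have c: "col H j \<in> carrier_vec n" using H by auto
    have "Matrix.vec n (\<lambda>_. 1) \<bullet> col H j = (if j = k then real n else 0)"
    proof (cases "j = k")
      case True
      then show ?thesis by (simp add: k scalar_prod_def)
    next
      case False
      then show ?thesis using orthogonal_matD[OF orth, of k j] H k j by auto
    qed
    then show ?thesis
      unfolding laplacian_complete_graph_mult_vec[OF c] using c k H by (auto intro!: eq_vecI)
  qed
  with H Q show ?thesis
    using laplacian_carrier[of "complete_graph n"]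
    by (intro diagonalizes_if_eigenvectors[where Q = Q]) (auto simp: complete_graph_def)
qed

section \<open>From a connected graph to the matrix\<close>

text \<open>Expanding the all-ones vector in the columns of \<open>P\<close>, any column that occurs
  with a nonzero coefficient must have eigenvalue 0, because the all-ones vector lies in the kernel.
  Connectedness then makes that column constant.\<close>

lemma constant_column_if_diagonalizes:
  assumes G: "pair_graph G" "pverts G = {..<n}" "Digraph_Component.connected (with_proj G)"
    and diag: "diagonalizes P (laplacian G)"
  obtains j c where "j < n" "col P j = c \<cdot>\<^sub>v Matrix.vec n (\<lambda>_. 1)"
proof -
  interpret pair_graph G by fact
  let ?L = "laplacian G" and ?one = "Matrix.vec n (\<lambda>_. 1) :: real vec"
  have L: "?L \<in> carrier_mat n n" using laplacian_carrier[of G] G(2) by simp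
  obtain Q where P: "P \<in> carrier_mat n n" and Q: "Q \<in> carrier_mat n n"
    and PQ: "P * Q = 1\<^sub>m n" and E: "diagonal_mat (Q * ?L * P)"
    using diagonalizesE[OF L diag] .
  define E' where "E' = Q * ?L * P"
  have E'c: "E' \<in> carrier_mat n n" using P Q L by (simp add: E'_def)
  have "P * E' = P * (Q * (?L * P))" by (simp add: E'_def assoc_mult_mat[OF Q L P])
  also have "\<dots> = ?L * P"
    using assoc_mult_mat[OF P Q, of "?L * P" n] L P PQ by simp
  finally have PE: "P * E' = ?L * P" .
  have "pverts G \<noteq> {}"
    using G(3) by (auto simp: Digraph_Component.connected_def strongly_connected_def)
  then have n: "n > 0" using G(2) by auto
  \<comment> \<open>These are the coordinates of the all-ones vector in the basis of columns of
    \<open>P\<close>.\<close>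
  define w where "w = Q *\<^sub>v ?one"
  have w: "w \<in> carrier_vec n" using Q by (simp add: w_def)
  have Pw: "P *\<^sub>v w = ?one"
    using assoc_mult_mat_vec[OF P Q, of ?one] PQ by (simp add: w_def)
  have L1: "?L *\<^sub>v ?one = 0\<^sub>v n"
  proof (rule eq_vecI)
    fix i assume "i < dim_vec (0\<^sub>v n :: real vec)"
    then have i: "i < n" by simp
    have "j < n" if "(i, j) \<in> parcs G" for j using in_arcsD2[OF that] G(2) by simp
    then have "(\<Sum>j | (i, j) \<in> parcs G. ?one $ i - ?one $ j) = 0"
      using i by (intro sum.neutral) simp
    then show "(?L *\<^sub>v ?one) $ i = 0\<^sub>v n $ i"
      using laplacian_mult_vec[OF G(1,2) vec_carrier i, of "\<lambda>_. 1"] i by simp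
  qed (use L in auto)
  have "E' *\<^sub>v w = Q *\<^sub>v (?L *\<^sub>v (P *\<^sub>v w))"
    unfolding E'_def using P Q L w
    by (simp add: assoc_mult_mat_vec[of _ n n _ n])
  also have "\<dots> = 0\<^sub>v n" using Q by (intro eq_vecI) (auto simp: Pw L1)
  finally have Ew: "E' *\<^sub>v w = 0\<^sub>v n" .
  have "w \<noteq> 0\<^sub>v n"
  proof
    assume "w = 0\<^sub>v n"
    then have "?one = P *\<^sub>v 0\<^sub>v n" using Pw by simp
    also have "\<dots> = 0\<^sub>v n" using P by (intro eq_vecI) auto
    finally have "?one = 0\<^sub>v n" .
    from arg_cong[OF this, of "\<lambda>v. v $ 0"] n show False by simp
  qed
  then obtain j where j: "j < n" "w $ j \<noteq> 0" using w
    by (metis carrier_vecD eq_vecI index_zero_vec)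
  have off: "E' $$ (i, l) = 0" if "i < n" "l < n" "i \<noteq> l" for i l
    using E E'c that by (auto simp: E'_def[symmetric] diagonal_mat_def)
  \<comment> \<open>Since \<open>E'\<close> is diagonal, coordinate \<open>j\<close> of
    \<open>E' *\<^sub>v w = 0\<^sub>v n\<close> isolates the eigenvalue of column
    \<open>j\<close>.\<close>
  have "(E' *\<^sub>v w) $ j = (\<Sum>l = 0..<n. E' $$ (j, l) * w $ l)"
    using E'c w j by (auto simp: scalar_prod_def)
  also have "\<dots> = E' $$ (j, j) * w $ j"
    using j off by (subst sum.remove[of _ j]) (auto intro!: sum.neutral)
  finally have "E' $$ (j, j) = 0" using Ew j by simp
  then have "E' $$ (i, j) = 0" if "i < n" for i
    using off[OF that j(1)] by (cases "i = j") auto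
  then have "col E' j = 0\<^sub>v n"
    using E'c j by (intro eq_vecI) auto
  then have "?L *\<^sub>v col P j = P *\<^sub>v 0\<^sub>v n"
    using col_mult2[OF L P j(1)] col_mult2[OF P E'c j(1)] PE by metis
  also have "\<dots> = 0\<^sub>v n" using P by (intro eq_vecI) auto
  finally have "?L *\<^sub>v col P j = 0\<^sub>v n" .
  moreover have "col P j \<in> carrier_vec n" using P by auto
  ultimately obtain c where "col P j = c \<cdot>\<^sub>v ?one"
    using laplacian_kernel_constant[OF G] by blast
  with j show thesis by (intro that)
qed

text \<open>A diagonal Gram matrix does not rule out zero columns; invertibility does. Over the
  reals a column with zero self-product is zero, against the diagonal entry 1 of
  \<open>Q * P\<close>.\<close>

lemma orthogonal_mat_if_diagonalizes:
  fixes P :: "real mat"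
  assumes A: "A \<in> carrier_mat n n" and diag: "diagonalizes P A" and PP: "diagonal_mat (P\<^sup>T * P)"
  shows "orthogonal_mat P"
proof -
  obtain Q where P: "P \<in> carrier_mat n n" and Q: "Q \<in> carrier_mat n n"
    and QP: "Q * P = 1\<^sub>m n"
    using diagonalizesE[OF A diag] .
  have "col P i \<bullet> col P i \<noteq> 0" if "i < n" for i
  proof
    assume 0: "col P i \<bullet> col P i = 0"
    have "col P i = 0\<^sub>v n"
      using 0 P by (auto simp: scalar_prod_def sum_nonneg_eq_0_iff intro!: eq_vecI)
    moreover have "row Q i \<bullet> col P i = 1"
      using arg_cong[OF QP, of "\<lambda>M. M $$ (i, i)"] P Q that by simp
    moreover have "row Q i \<in> carrier_vec n" using Q by auto
    ultimately show False by simp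
  qed
  with PP P show ?thesis by (auto simp: orthogonal_mat_def)
qed

lemma orthogonal_mat_smult:
  fixes A :: "'a :: idom mat"
  assumes "orthogonal_mat A" "c \<noteq> 0"
  shows "orthogonal_mat (c \<cdot>\<^sub>m A)"
proof (rule orthogonal_matI)
  fix i j assume "i < dim_col (c \<cdot>\<^sub>m A)" "j < dim_col (c \<cdot>\<^sub>m A)"
  then show "(col (c \<cdot>\<^sub>m A) i \<bullet> col (c \<cdot>\<^sub>m A) j = 0) = (i \<noteq> j)"
    using assms orthogonal_matD[OF assms(1), of i j] by simp
qed

lemma matrix_of_connected_graph:
  assumes G: "pair_graph G" "pverts G = {..<n}" "Digraph_Component.connected (with_proj G)"
    and bw: "S_bandwidth {-1, 0, 1} G = 1"
  shows "\<exists>H :: real mat. H \<in> carrier_mat n n \<and> elements_mat H \<subseteq> {-1, 0, 1} \<and>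
           orthogonal_mat H \<and> Matrix.vec n (\<lambda>_. 1) \<in> set (cols H)"
proof -
  have L: "laplacian G \<in> carrier_mat n n" using laplacian_carrier[of G] G(2) by simp
  from bw obtain P where P: "elements_mat P \<subseteq> {-1, 0, 1}" and diag: "diagonalizes P (laplacian G)"
    and PP: "diagonal_mat (P\<^sup>T * P)"
    by (auto simp: S_bandwidth_eq_1_iff)
  have Pc: "P \<in> carrier_mat n n" using diag L by (auto simp: diagonalizes_def)
  have orth: "orthogonal_mat P" by (rule orthogonal_mat_if_diagonalizes[OF L diag PP])
  obtain j c where j: "j < n" and c: "col P j = c \<cdot>\<^sub>v Matrix.vec n (\<lambda>_. 1)"
    using constant_column_if_diagonalizes[OF G diag] .
  have "c \<noteq> 0"
  proof
    assume "c = 0"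
    then have "col P j \<bullet> col P j = 0" by (simp add: c scalar_prod_def)
    then show False using orthogonal_matD[OF orth, of j j] Pc j by simp
  qed
  \<comment> \<open>Every entry of column \<open>j\<close> equals \<open>c\<close>, so
    \<open>c\<close> is itself an entry of \<open>P\<close> and, being nonzero, is 1 or -1.\<close>
  moreover have "c = P $$ (j, j)"
    using arg_cong[OF c, of "\<lambda>v. v $ j"] Pc j by simp
  then have "c \<in> elements_mat P" using Pc j by blast
  ultimately have c1: "c = 1 \<or> c = -1" using P by blast
  \<comment> \<open>As \<open>c * c = 1\<close>, multiplying by \<open>c\<close> itself turns column
    \<open>j\<close> into the all-ones vector and keeps the entries in {-1, 0, 1}.\<close>
  let ?H = "c \<cdot>\<^sub>m P"
  have "elements_mat ?H \<subseteq> {-1, 0, 1}"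
  proof
    fix x assume "x \<in> elements_mat ?H"
    then obtain i l where "i < n" "l < n" "x = c * P $$ (i, l)" using Pc by auto
    moreover from this have "P $$ (i, l) \<in> {-1, 0, 1}" using P Pc by blast
    ultimately show "x \<in> {-1, 0, 1}" using c1 by auto
  qed
  moreover have "col ?H j = Matrix.vec n (\<lambda>_. 1)"
    using c c1 Pc j by (auto simp: smult_smult_assoc)
  then have "Matrix.vec n (\<lambda>_. 1) \<in> set (cols ?H)"
    using Pc j by (metis carrier_matD(2) cols_length cols_nth index_smult_mat(3) nth_mem)
  ultimately show ?thesis
    using Pc orthogonal_mat_smult[OF orth \<open>c \<noteq> 0\<close>] by (intro exI[of _ ?H]) auto
qed

theorem theorem4p6:
  fixes n :: nat
  assumes "n > 0"
  shows "((\<exists>H :: real mat. H \<in> carrier_mat n n \<and> elements_mat H \<subseteq> {-1, 0, 1} \<and>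
             Matrix.orthogonal (cols H) \<and> Matrix.vec n (\<lambda>_. 1) \<in> set (cols H))
           \<longleftrightarrow> S_bandwidth {-1, 0, 1} (complete_graph n) = 1) \<and>
         ((\<exists>G :: nat pair_pre_digraph. pair_graph G \<and> pverts G = {..<n} \<and>
             Digraph_Component.connected (with_proj G) \<and> S_bandwidth {-1, 0, 1} G = 1)
           \<longleftrightarrow> S_bandwidth {-1, 0, 1} (complete_graph n) = 1)"
    (is "(?a \<longleftrightarrow> ?c) \<and> (?b \<longleftrightarrow> ?c)")
proof -
  \<comment> \<open>The implications form a cycle. Here \<open>H\<close> itself serves as the
    diagonalizing matrix; next, the complete graph serves as the connected graph, with
    \<open>n > 0\<close> supplying a nonempty vertex set.\<close>
  have "?a \<Longrightarrow> ?c"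
    using diagonalizes_laplacian_complete_graph
    by (auto simp: S_bandwidth_eq_1_iff orthogonal_cols_iff orthogonal_mat_def Let_def)
  moreover have "?c \<Longrightarrow> ?b"
    using pair_graph_complete_graph connected_complete_graph[OF assms]
    by (intro exI[of _ "complete_graph n"]) (auto simp: complete_graph_def)
  moreover have "?b \<Longrightarrow> ?a"
    using matrix_of_connected_graph by (auto simp: orthogonal_cols_iff)
  ultimately show ?thesis by blast
qed

end
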